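(* Let $m\ge 3$ and $n\ge 2$ be integers, and let $\mathbb{I}$ be the unit tensor of order $m$ and dimension $n$. Suppose that $P$ and $Q$ are two complex matrices of order $n$ with $P\mathbb{I}Q=\mathbb{I}$. Then there exist a permutation $\sigma\in S_n$ of the set $[n]$, with permutation matrix $R_\sigma$, and an invertible diagonal matrix $D$ of order $n$ such that $Q=DR_\sigma$ and $P=R_\sigma^{T}D^{1-m}$.
   Context: Write $[n]=\{1,\ldots,n\}$. An order $m$ dimension $n$ tensor $\mathbb{A}=(a_{i_1i_2\ldots i_m})$ is a multidimensional array of complex numbers $a_{i_1\ldots i_m}$ indexed by $i_1,\ldots,i_m\in[n]$; a square matrix of order $n$ is an order $2$ dimension $n$ tensor. The unit tensor of order $m$ and dimension $n$ is $\mathbb{I}=(\delta_{i_1i_2\ldots i_m})$ with $\delta_{i_1\ldots i_m}=1$ if $i_1=i_2=\cdots=i_m$ and $0$ otherwise. Tensor product: for $\mathbb{A}$ of order $m\ge 2$ and $\mathbb{B}$ of order $k\ge 1$, both of dimension $n$, $\mathbb{A}\mathbb{B}$ is the tensor of order $(m-1)(k-1)+1$ and dimension $n$ with entries $$(\mathbb{A}\mathbb{B})_{i\alpha_1\ldots\alpha_{m-1}}=\sum_{i_2,\ldots,i_m=1}^n a_{ii_2\ldots i_m}b_{i_2\alpha_1}\cdots b_{i_m\alpha_{m-1}}\quad (i\in[n],\ \alpha_1,\ldots,\alpha_{m-1}\in[n]^{k-1}).$$ This product is associative. In particular, for matrices $P,Q$ of order $n$ and $\mathbb{A}$ of order $m$,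 $(P\mathbb{A}Q)_{i_1\ldots i_m}=\sum_{j_1,\ldots,j_m=1}^n p_{i_1j_1}a_{j_1j_2\ldots j_m}q_{j_2i_2}\cdots q_{j_mi_m}$. The permutation matrix $R_\sigma=(r_{ij})$ of $\sigma\in S_n$ is defined by $r_{ij}=1$ if $j=\sigma(i)$ and $r_{ij}=0$ otherwise. *)

theory Defs
  imports
    "Jordan_Normal_Form.Matrix"
    "Jordan_Normal_Form.Gauss_Jordan_Elimination"
    "HOL-Combinatorics.Permutations"
    "HOL-Library.FuncSet"
begin

text \<open>
  The index set \<open>[n]\<close> is rendered as \<open>{..<n}\<close>, following the convention for matrices.
  A tensor of order \<open>m\<close> and dimension \<open>n\<close> is a function on the lists of length \<open>m\<close> over
  \<open>{..<n}\<close>. As it is \<open>undefined\<close> on all other lists, equality of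
  tensors of the same order and dimension is equality of functions.
\<close>

type_synonym 'a tensor = "nat list \<Rightarrow> 'a"

definition tensor_index :: "nat \<Rightarrow> nat \<Rightarrow> nat list set" where
  "tensor_index n m = {is. length is = m \<and> set is \<subseteq> {..<n}}"

definition unit_tensor :: "nat \<Rightarrow> nat \<Rightarrow> 'a :: zero_neq_one tensor" where
  "unit_tensor n m =
    (\<lambda>is \<in> tensor_index n m. if \<forall>i \<in> set is. \<forall>j \<in> set is. i = j then 1 else 0)"

definition tensor_of_mat :: "'a mat \<Rightarrow> 'a tensor" where
  "tensor_of_mat A = (\<lambda>is \<in> tensor_index (dim_row A) 2. A $$ (is ! 0, is ! 1))"

text \<open>
  \<open>tensor_prod n m k A B\<close> is the product of \<open>A\<close> of order \<open>m \<ge> 2\<close> and \<open>B\<close> of order \<open>k \<ge> 1\<close>,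
  both of dimension \<open>n\<close>. An index \<open>i \<alpha>\<^sub>1 \<dots> \<alpha>\<^sub>m\<^sub>-\<^sub>1\<close> of the product is the concatenation of \<open>i\<close> and
  the \<open>m - 1\<close> blocks \<open>\<alpha>\<^sub>t\<close>, each of length \<open>k - 1\<close>; \<open>index_block\<close> counts the blocks from 0.
\<close>

definition index_block :: "nat \<Rightarrow> nat \<Rightarrow> nat list \<Rightarrow> nat list" where
  "index_block k t as = take (k - 1) (drop (t * (k - 1)) as)"

definition tensor_prod ::
    "nat \<Rightarrow> nat \<Rightarrow> nat \<Rightarrow> 'a :: comm_semiring_1 tensor \<Rightarrow> 'a tensor \<Rightarrow> 'a tensor" where
  "tensor_prod n m k A B =
    (\<lambda>is \<in> tensor_index n ((m - 1) * (k - 1) + 1).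
      \<Sum>js \<in> tensor_index n (m - 1).
        A (hd is # js) * (\<Prod>t < m - 1. B (js ! t # index_block k t (tl is))))"

definition perm_matrix :: "nat \<Rightarrow> (nat \<Rightarrow> nat) \<Rightarrow> 'a :: zero_neq_one mat" where
  "perm_matrix n \<sigma> = mat n n (\<lambda>(i, j). if j = \<sigma> i then 1 else 0)"

text \<open>
  Integer powers of matrices. For a negative exponent, \<open>A\<close> must be invertible, since
  \<open>mat_inverse A = None\<close> otherwise.
\<close>

definition mat_powi :: "'a :: field mat \<Rightarrow> int \<Rightarrow> 'a mat" where
  "mat_powi A z =
    (if z \<ge> 0 then A ^\<^sub>m nat z else the (mat_inverse A) ^\<^sub>m nat (- z))"

end

theory Submission
  imports Defs "Jordan_Normal_Form.Determinant"
begin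

text \<open>
  Write \<open>P = (p\<^sub>i\<^sub>j)\<close>, \<open>Q = (q\<^sub>i\<^sub>j)\<close>. Since the unit tensor \<open>I\<close> only keeps the terms with equal
  summation indices, the equation \<open>P I Q = I\<close> says that
  \<open>\<Sum>j. p\<^sub>i\<^sub>j q\<^sub>j\<^sub>a \<cdots> q\<^sub>j\<^sub>z\<close>, with \<open>m - 1\<close> factors from \<open>Q\<close>, is 1 if \<open>i = a = \<cdots> = z\<close> and 0 otherwise
  (\<open>mat_unit_mat_tensor_prod_entry\<close>). Two kinds of indices suffice.

  Taking \<open>a = \<cdots> = z\<close> gives \<open>P S = 1\<close>, where \<open>S\<close> is the entrywise power of \<open>Q\<close> with exponent \<open>m - 1\<close>.
  Hence also \<open>S P = 1\<close>, and neither a row nor a column of \<open>Q\<close> vanishes.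

  Taking one index \<open>l\<close> and \<open>m - 2\<close> indices \<open>k \<noteq> l\<close> shows that \<open>P\<close> annihilates the vector with entries
  \<open>q\<^sub>j\<^sub>l q\<^sub>j\<^sub>k\<close> to the powers 1 and \<open>m - 2\<close>. As \<open>P\<close> is invertible, this vector is zero, and as
  \<open>m - 2 > 0\<close>, no row of \<open>Q\<close> has nonzero entries in both columns \<open>k\<close> and \<open>l\<close>. For
  \<open>m = 2\<close> there is no index \<open>k\<close>, and indeed every invertible \<open>Q\<close> is then possible.

  So each row \<open>j\<close> of \<open>Q\<close> has exactly one nonzero entry \<open>d\<^sub>j\<close>, in a column \<open>\<sigma> j\<close>; the map \<open>\<sigma>\<close> is
  surjective because no column of \<open>Q\<close> vanishes. The formula for \<open>P\<close> is then read off from \<open>S P = 1\<close>.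
\<close>

lemma tensor_index_Cons [simp]:
  "i # is \<in> tensor_index n (Suc k) \<longleftrightarrow> i < n \<and> is \<in> tensor_index n k"
  by (auto simp: tensor_index_def)

lemma finite_tensor_index [simp]: "finite (tensor_index n k)"
  using finite_lists_length_eq[of "{..<n}" k] by (simp add: tensor_index_def conj_commute)

lemma tensor_index_nth: "is \<in> tensor_index n k \<Longrightarrow> t < k \<Longrightarrow> is ! t < n"
  by (auto simp: tensor_index_def dest: nth_mem)

lemma sum_tensor_index_1: "(\<Sum>js\<in>tensor_index n (Suc 0). f js) = (\<Sum>j<n. f [j])"
proof -
  have "tensor_index n (Suc 0) = (\<lambda>j. [j]) ` {..<n}"
    by (auto simp: tensor_index_def length_Suc_conv)
  thus ?thesis by (simp add: sum.reindex inj_on_def)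
qed

lemma tensor_of_mat_entry:
  "A \<in> carrier_mat n n \<Longrightarrow> i < n \<Longrightarrow> j < n \<Longrightarrow> tensor_of_mat A [i, j] = A $$ (i, j)"
  by (auto simp: tensor_of_mat_def tensor_index_def)

lemma unit_tensor_Cons:
  assumes "j < n" "js \<in> tensor_index n k"
  shows "unit_tensor n (Suc k) (j # js) = (if js = replicate k j then 1 else 0)"
proof -
  have "(\<forall>i\<in>set (j # js). \<forall>l\<in>set (j # js). i = l) \<longleftrightarrow> (\<forall>i\<in>set js. i = j)"
    by (metis list.set_intros(1) list.set_intros(2) set_ConsD)
  also have "\<dots> \<longleftrightarrow> js = replicate k j"
    using assms(2) by (metis (mono_tags) in_set_replicate mem_Collect_eq replicate_length_same tensor_index_def)
  finally show ?thesis using assms by (simp add: unit_tensor_def)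
qed

lemma mat_tensor_prod_entry:
  assumes "P \<in> carrier_mat n n" "i < n" "js \<in> tensor_index n k"
  shows "tensor_prod n 2 (Suc k) (tensor_of_mat P) A (i # js) = (\<Sum>j<n. P $$ (i, j) * A (j # js))"
proof -
  have "take k js = js" using assms(3) by (simp add: tensor_index_def)
  thus ?thesis using assms
    by (simp add: tensor_prod_def sum_tensor_index_1 index_block_def tensor_of_mat_entry)
qed

lemma tensor_prod_mat_entry:
  assumes "Q \<in> carrier_mat n n" "i < n" "is \<in> tensor_index n k"
  shows "tensor_prod n (Suc k) 2 A (tensor_of_mat Q) (i # is) =
    (\<Sum>js\<in>tensor_index n k. A (i # js) * (\<Prod>t<k. Q $$ (js ! t, is ! t)))"
proof -
  have "index_block 2 t is = [is ! t]" if "t < k" for t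
    using that assms(3) by (simp add: index_block_def tensor_index_def take_Suc hd_drop_conv_nth)
  hence "(\<Prod>t<k. tensor_of_mat Q (js ! t # index_block 2 t is)) = (\<Prod>t<k. Q $$ (js ! t, is ! t))"
    if "js \<in> tensor_index n k" for js
    using that assms by (auto simp: tensor_of_mat_entry tensor_index_nth intro!: prod.cong)
  thus ?thesis using assms by (simp add: tensor_prod_def cong: sum.cong)
qed

text \<open>
  In the sum over the index lists \<open>js\<close>, the factor \<open>unit_tensor n (Suc k) (j # js)\<close> selects the
  constant list \<open>js = (j, \<dots>, j)\<close>, which leaves the single summation index \<open>j\<close>.
\<close>

lemma mat_unit_mat_tensor_prod_entry:
  assumes "P \<in> carrier_mat n n" "Q \<in> carrier_mat n n" "i < n" "is \<in> tensor_index n k"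
  shows "tensor_prod n (Suc k) 2
      (tensor_prod n 2 (Suc k) (tensor_of_mat P) (unit_tensor n (Suc k))) (tensor_of_mat Q) (i # is)
    = (\<Sum>j<n. P $$ (i, j) * (\<Prod>t<k. Q $$ (j, is ! t)))" (is "?L = _")
proof -
  have "?L = (\<Sum>js\<in>tensor_index n k. (\<Sum>j<n. P $$ (i, j) * unit_tensor n (Suc k) (j # js))
      * (\<Prod>t<k. Q $$ (js ! t, is ! t)))"
    using assms by (simp add: tensor_prod_mat_entry mat_tensor_prod_entry cong: sum.cong)
  also have "\<dots> = (\<Sum>j<n. \<Sum>js\<in>tensor_index n k.
      if js = replicate k j then P $$ (i, j) * (\<Prod>t<k. Q $$ (js ! t, is ! t)) else 0)"
    unfolding sum_distrib_right
    by (subst sum.swap) (auto simp: unit_tensor_Cons intro!: sum.cong)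
  also have "\<dots> = (\<Sum>j<n. P $$ (i, j) * (\<Prod>t<k. Q $$ (j, is ! t)))"
  proof (rule sum.cong[OF refl])
    fix j assume "j \<in> {..<n}"
    hence "replicate k j \<in> tensor_index n k" by (auto simp: tensor_index_def)
    thus "(\<Sum>js\<in>tensor_index n k.
        if js = replicate k j then P $$ (i, j) * (\<Prod>t<k. Q $$ (js ! t, is ! t)) else 0)
      = P $$ (i, j) * (\<Prod>t<k. Q $$ (j, is ! t))"
      by (simp add: sum.delta)
  qed
  finally show ?thesis .
qed

lemma pow_mat_diag: "mat_diag n d ^\<^sub>m k = mat_diag n (\<lambda>i. d i ^ k)"
  by (induction k) (simp_all add: power_commutes mat_diag_def[THEN arg_cong, of dim_row])

lemma mat_diag_inverse:
  fixes d :: "nat \<Rightarrow> 'a :: field"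
  assumes "\<And>i. i < n \<Longrightarrow> d i \<noteq> 0"
  shows "mat_diag n d * mat_diag n (\<lambda>i. inverse (d i)) = 1\<^sub>m n"
    and "mat_diag n (\<lambda>i. inverse (d i)) * mat_diag n d = 1\<^sub>m n"
  using assms by (auto simp: mat_diag_diag intro!: eq_matI) (auto simp: mat_diag_def)

lemma invertible_mat_diag:
  fixes d :: "nat \<Rightarrow> 'a :: field"
  assumes "\<And>i. i < n \<Longrightarrow> d i \<noteq> 0"
  shows "invertible_mat (mat_diag n d)"
  unfolding invertible_mat_def inverts_mat_def
  using mat_diag_inverse[of n d] assms
  by (metis mat_diag_dim carrier_matD square_mat.elims(3))

text \<open>
  As \<open>mat_inverse\<close> is computed by Gauss-Jordan elimination, its value is not unfolded but identified
  by the uniqueness of inverses.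
\<close>

lemma mat_inverse_mat_diag:
  fixes d :: "nat \<Rightarrow> 'a :: field"
  assumes "\<And>i. i < n \<Longrightarrow> d i \<noteq> 0"
  shows "mat_inverse (mat_diag n d) = Some (mat_diag n (\<lambda>i. inverse (d i)))"
proof (cases "mat_inverse (mat_diag n d)")
  case None
  have "mat_diag n d \<in> Units (ring_mat TYPE('a) n ())"
    using mat_diag_inverse[of n d] assms mat_diag_dim unfolding Units_def ring_mat_simps by blast
  thus ?thesis using mat_inverse(1)[OF mat_diag_dim None, where b = "()"] by blast
next
  case (Some B)
  have B: "B * mat_diag n d = 1\<^sub>m n" "B \<in> carrier_mat n n"
    using mat_inverse(2)[OF mat_diag_dim Some] by auto
  have "B = B * (mat_diag n d * mat_diag n (\<lambda>i. inverse (d i)))"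
    by (subst mat_diag_inverse(1)) (use assms B in simp_all)
  also have "\<dots> = mat_diag n (\<lambda>i. inverse (d i))"
    unfolding assoc_mult_mat[OF B(2) mat_diag_dim mat_diag_dim, symmetric] B(1)
    by (rule left_mult_one_mat[OF mat_diag_dim])
  finally show ?thesis using Some by simp
qed

lemma mat_powi_mat_diag:
  fixes d :: "nat \<Rightarrow> 'a :: field"
  assumes "\<And>i. i < n \<Longrightarrow> d i \<noteq> 0"
  shows "mat_powi (mat_diag n d) (- int k) = mat_diag n (\<lambda>i. inverse (d i ^ k))"
proof (cases k)
  case 0
  thus ?thesis by (simp add: mat_powi_def pow_mat_diag del: pow_mat.simps)
next
  case Suc
  thus ?thesis using assms
    by (simp add: mat_powi_def mat_inverse_mat_diag pow_mat_diag power_inverse del: of_nat_Suc power_Suc pow_mat.simps)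
qed

lemma mat_diag_mult_perm_matrix:
  fixes d :: "nat \<Rightarrow> 'a :: comm_semiring_1"
  shows "mat_diag n d * perm_matrix n \<sigma> = mat n n (\<lambda>(i, j). if j = \<sigma> i then d i else 0)"
  by (subst mat_diag_mult_left[of _ n n]) (auto simp: perm_matrix_def intro!: eq_matI)

lemma transpose_perm_matrix_mult_mat_diag:
  fixes d :: "nat \<Rightarrow> 'a :: comm_semiring_1"
  shows "transpose_mat (perm_matrix n \<sigma>) * mat_diag n d = mat n n (\<lambda>(i, j). if i = \<sigma> j then d j else 0)"
  by (subst mat_diag_mult_right[of _ n n]) (auto simp: perm_matrix_def intro!: eq_matI)

theorem theorem2p3:
  fixes m n :: nat and P Q :: "complex mat"
  assumes "m \<ge> 3" and "n \<ge> 2"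
    and "P \<in> carrier_mat n n" and "Q \<in> carrier_mat n n"
    and "tensor_prod n m 2
           (tensor_prod n 2 m (tensor_of_mat P) (unit_tensor n m)) (tensor_of_mat Q)
         = unit_tensor n m"
  shows "\<exists>\<sigma> D. \<sigma> permutes {..<n} \<and>
           D \<in> carrier_mat n n \<and> diagonal_mat D \<and> invertible_mat D \<and>
           Q = D * perm_matrix n \<sigma> \<and>
           P = transpose_mat (perm_matrix n \<sigma>) * mat_powi D (1 - int m)"
proof -
  note P = assms(3) and Q = assms(4)
  obtain r where m: "m = Suc (Suc r)" and r: "r > 0"
    using assms(1) by (metis Suc_le_D numeral_3_eq_3 Suc_le_mono zero_less_Suc)
  \<comment> \<open>The entrywise power of \<open>Q\<close> with exponent \<open>m - 1 = Suc r\<close>, which turns out to be the inverse of \<open>P\<close>.\<close>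
  define S where "S = mat n n (\<lambda>(j, k). Q $$ (j, k) ^ Suc r)"
  have S: "S \<in> carrier_mat n n" by (simp add: S_def)
  \<comment> \<open>The index lists \<open>(i, l, k, \<dots>, k)\<close> are the only ones used: \<open>k = l\<close> computes \<open>P * S\<close>,
    and \<open>k \<noteq> l\<close> gives vectors in the kernel of \<open>P\<close>.\<close>
  have entry: "(\<Sum>j<n. P $$ (i, j) * (Q $$ (j, l) * Q $$ (j, k) ^ r)) = (if k = i \<and> l = i then 1 else 0)"
    if "i < n" "k < n" "l < n" for i k l
  proof -
    let ?is = "l # replicate r k"
    have ls: "?is \<in> tensor_index n (Suc r)" using that by (auto simp: tensor_index_def)
    have "(\<Sum>j<n. P $$ (i, j) * (\<Prod>t<Suc r. Q $$ (j, ?is ! t)))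
        = unit_tensor n m (i # ?is)"
      using mat_unit_mat_tensor_prod_entry[OF P Q that(1) ls] assms(5) by (simp only: m)
    also have "\<dots> = (if k = i \<and> l = i then 1 else 0)"
      using unit_tensor_Cons[OF that(1) ls] r by (auto simp: m)
    finally show ?thesis by (simp add: prod.lessThan_Suc_shift del: prod.lessThan_Suc)
  qed
  have "P * S = 1\<^sub>m n"
    using P S entry by (auto simp: S_def scalar_prod_def atLeast0LessThan intro!: eq_matI)
  hence SP: "S * P = 1\<^sub>m n" by (rule mat_mult_left_right_inverse[OF P S])
  have SP_entry: "(\<Sum>k<n. Q $$ (j, k) ^ Suc r * P $$ (k, i)) = (if j = i then 1 else 0)"
    if "i < n" "j < n" for i j
    using arg_cong[OF SP, of "\<lambda>A. A $$ (j, i)"] that P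
    by (simp add: S_def scalar_prod_def atLeast0LessThan)
  have row_unique: "k = l" if "j < n" "k < n" "l < n" "Q $$ (j, k) \<noteq> 0" "Q $$ (j, l) \<noteq> 0" for j k l
  proof (rule ccontr)
    assume "k \<noteq> l"
    define v where "v = vec n (\<lambda>j. Q $$ (j, l) * Q $$ (j, k) ^ r)"
    have v: "v \<in> carrier_vec n" by (simp add: v_def)
    have Pv: "P *\<^sub>v v = 0\<^sub>v n"
      using P entry \<open>k \<noteq> l\<close> that by (auto simp: v_def scalar_prod_def atLeast0LessThan intro!: eq_vecI)
    have "v = (S * P) *\<^sub>v v" using SP v by simp
    also have "\<dots> = 0\<^sub>v n"
      unfolding assoc_mult_mat_vec[OF S P v] Pv using S by (intro eq_vecI) auto
    finally have "v = 0\<^sub>v n" .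
    hence "v $ j = 0" using that by simp
    thus False using that by (simp add: v_def)
  qed
  have "\<exists>k<n. Q $$ (j, k) \<noteq> 0" if "j < n" for j
  proof (rule ccontr)
    assume "\<not> ?thesis"
    thus False using SP_entry[OF that that] by simp
  qed
  then obtain s where s: "\<And>j. j < n \<Longrightarrow> s j < n \<and> Q $$ (j, s j) \<noteq> 0" by metis
  \<comment> \<open>\<open>permutes\<close> requires the identity outside of \<open>{..<n}\<close>.\<close>
  define \<sigma> where "\<sigma> j = (if j < n then s j else j)" for j
  define d where "d j = Q $$ (j, \<sigma> j)" for j
  have \<sigma>: "\<sigma> j < n" "d j \<noteq> 0" if "j < n" for j using s[OF that] that by (auto simp: \<sigma>_def d_def)
  have Q_entry: "Q $$ (j, k) = (if k = \<sigma> j then d j else 0)" if "j < n" "k < n" for j k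
  proof (cases "k = \<sigma> j")
    case True
    thus ?thesis by (simp add: d_def)
  next
    case False
    have "Q $$ (j, \<sigma> j) \<noteq> 0" using \<sigma>(2)[OF that(1)] by (simp add: d_def)
    hence "Q $$ (j, k) = 0" using row_unique[OF that \<sigma>(1)[OF that(1)]] False by blast
    thus ?thesis using False by simp
  qed
  have "{..<n} \<subseteq> \<sigma> ` {..<n}"
  proof
    fix l assume "l \<in> {..<n}"
    hence l: "l < n" by simp
    show "l \<in> \<sigma> ` {..<n}"
    proof (rule ccontr)
      assume "l \<notin> \<sigma> ` {..<n}"
      hence "Q $$ (j, l) = 0" if "j < n" for j using that l by (auto simp: Q_entry)
      thus False using entry[OF l l l] by simp
    qed
  qed
  hence "\<sigma> ` {..<n} = {..<n}" using \<sigma> by auto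
  hence bij: "bij_betw \<sigma> {..<n} {..<n}" by (simp add: bij_betw_def eq_card_imp_inj_on)
  hence perm: "\<sigma> permutes {..<n}" by (rule bij_imp_permutes) (simp add: \<sigma>_def)
  \<comment> \<open>Row \<open>j\<close> of \<open>S * P = 1\<close>: the only nonzero entry in row \<open>j\<close> of \<open>S\<close> is in column \<open>\<sigma> j\<close>.\<close>
  have P_entry: "P $$ (\<sigma> j, i) = (if j = i then inverse (d j ^ Suc r) else 0)" if "i < n" "j < n" for i j
  proof -
    have "(\<Sum>k<n. Q $$ (j, k) ^ Suc r * P $$ (k, i)) =
        (\<Sum>k<n. if k = \<sigma> j then d j ^ Suc r * P $$ (k, i) else 0)"
      using that by (intro sum.cong) (auto simp: Q_entry)
    also have "\<dots> = d j ^ Suc r * P $$ (\<sigma> j, i)"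
      using \<sigma>[OF that(2)] by simp
    finally have "d j ^ Suc r * P $$ (\<sigma> j, i) = (if j = i then 1 else 0)"
      using SP_entry[OF that] by simp
    moreover have "d j ^ Suc r \<noteq> 0" using \<sigma>[OF that(2)] by simp
    ultimately show ?thesis by (auto simp: inverse_unique simp del: power_Suc)
  qed
  have "Q = mat_diag n d * perm_matrix n \<sigma>"
    unfolding mat_diag_mult_perm_matrix using Q by (auto simp: Q_entry intro!: eq_matI)
  moreover have "P = transpose_mat (perm_matrix n \<sigma>) * mat_diag n (\<lambda>i. inverse (d i ^ Suc r))"
    unfolding transpose_perm_matrix_mult_mat_diag
  proof (rule eq_matI, goal_cases)
    case (1 k i)
    then obtain j where j: "k = \<sigma> j" "j < n"
      using bij by (auto simp: bij_betw_def image_iff)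
    have "\<sigma> j = \<sigma> i \<longleftrightarrow> j = i" using perm by (metis permutes_inj injD)
    thus ?case using 1 P_entry[of i j] j by (auto simp: \<sigma>)
  qed (use P in auto)
  moreover have "mat_powi (mat_diag n d) (1 - int m) = mat_diag n (\<lambda>i. inverse (d i ^ Suc r))"
    using mat_powi_mat_diag[of n d "Suc r"] \<sigma> by (simp add: m)
  moreover have "diagonal_mat (mat_diag n d)" by (auto simp: diagonal_mat_def mat_diag_def)
  moreover have "invertible_mat (mat_diag n d)" using \<sigma> by (intro invertible_mat_diag)
  ultimately show ?thesis using perm by (metis mat_diag_dim)
qed

end
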